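(* Let $S^{\circ}$ be a point process in $\mathbb{R}^d$ with a point at the origin, $0\in S^{\circ}$. Let $\pi_n$, $n\in\mathbb{Z}$, be point maps and let $\theta_{\pi_n}$ be the associated point shifts. Suppose that $$\pi_{-n}\,\theta_{\pi_n}=-\pi_n\qquad\text{for all } n\in\mathbb{Z},$$ that the points $X_n=\pi_n(S^{\circ})$, $n\in\mathbb{Z}$, are all distinct, and that $S^{\circ}=\{X_n:n\in\mathbb{Z}\}$ almost surely. If $$S^{\circ}-X_n=S^{\circ}\quad\text{in distribution, for every } n\in\mathbb{Z},$$ then $S^{\circ}$ is point-stationary.
   Context: A point process is a random locally finite set of points in $\mathbb{R}^d$. For $\omega\subset\mathbb{R}^d$, $\omega-x=\{s-x:s\in\omega\}$. A point map is a measurable map $\pi$ assigning to a locally finite configuration $\omega$ containing $0$ a point $\pi(\omega)\in\omega$; the associated point shift is $\theta_{\pi}(\omega)=\omega-\pi(\omega)$. Thus $\pi_{-n}\theta_{\pi_n}=-\pi_n$ means $\pi_{-n}(\omega-\pi_n(\omega))=-\pi_n(\omega)$. Point-stationarity (Thorisson): $S^{\circ}$, with $0\in S^{\circ}$, is point-stationary if for every shift-measurable stationary random field $Y=(Y_u:u\in\mathbb{R}^d)$ independent of $S^{\circ}$ one has $$S^{\circ}-\pi(S^{\circ},Y)=S^{\circ}\quad\text{in distribution}$$ for every measurable $\pi$ with $\pi(\omega,y)\in\omega$ whose associated point-shift is a bijection. Here the associated point-shift is $(\omega,y)\mapsto(\omega-\pi(\omega,y),\,(y_{\pi(\omega,y)+u})_{u\in\mathbb{R}^d})$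 acting on pairs consisting of a configuration $\omega\ni 0$ and a field realization $y$; shift-measurable means that the path space of $Y$ is closed under shifts and the map $(y,v)\mapsto (y_{v+u})_{u\in\mathbb{R}^d}$ is jointly measurable; stationary means that $(Y_{v+u})_{u}$ has the same distribution as $Y$ for all $v\in\mathbb{R}^d$. *)

theory Defs
  imports "HOL-Probability.Probability"
begin

definition locally_finite :: "(real ^ 'd) set \<Rightarrow> bool" where
  "locally_finite \<omega> \<longleftrightarrow> (\<forall>B. bounded B \<longrightarrow> finite (\<omega> \<inter> B))"

text \<open>The \<sigma>-algebra on configurations is the usual one for point processes: the smallest one
  making all counts of points in bounded Borel sets measurable.\<close>

definition configurations :: "(real ^ 'd) set measure" where
  "configurations = sigma {\<omega>. locally_finite \<omega>}
     {{\<omega>. locally_finite \<omega> \<and> card (\<omega> \<inter> B) = k} | B k. B \<in> sets borel \<and> bounded B}"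

definition configurations0 :: "(real ^ 'd) set measure" where
  "configurations0 = restrict_space configurations {\<omega>. 0 \<in> \<omega>}"

definition config_shift :: "(real ^ 'd) set \<Rightarrow> real ^ 'd \<Rightarrow> (real ^ 'd) set" where
  "config_shift \<omega> x = (\<lambda>s. s - x) ` \<omega>"

definition point_map :: "((real ^ 'd) set \<Rightarrow> real ^ 'd) \<Rightarrow> bool" where
  "point_map \<pi> \<longleftrightarrow> \<pi> \<in> configurations0 \<rightarrow>\<^sub>M borel \<and> (\<forall>\<omega>\<in>space configurations0. \<pi> \<omega> \<in> \<omega>)"

definition point_shift :: "((real ^ 'd) set \<Rightarrow> real ^ 'd) \<Rightarrow> (real ^ 'd) set \<Rightarrow> (real ^ 'd) set" where
  "point_shift \<pi> \<omega> = config_shift \<omega> (\<pi> \<omega>)"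

text \<open>A random field takes values in a measurable space \<open>E\<close> and has its paths in a set \<open>L\<close> of
  functions; the path space carries the \<sigma>-algebra generated by the evaluations
  \<open>y \<mapsto> y u\<close>, i.e. the trace on \<open>L\<close> of the product \<sigma>-algebra.\<close>

definition path_space :: "'e measure \<Rightarrow> (real ^ 'd \<Rightarrow> 'e) set \<Rightarrow> (real ^ 'd \<Rightarrow> 'e) measure" where
  "path_space E L = restrict_space (PiM UNIV (\<lambda>_. E)) L"

definition field_shift :: "(real ^ 'd \<Rightarrow> 'e) \<Rightarrow> real ^ 'd \<Rightarrow> (real ^ 'd \<Rightarrow> 'e)" where
  "field_shift y v = (\<lambda>u. y (v + u))"

definition shift_measurable :: "'e measure \<Rightarrow> (real ^ 'd \<Rightarrow> 'e) set \<Rightarrow> bool" where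
  "shift_measurable E L \<longleftrightarrow>
     L \<subseteq> space (PiM UNIV (\<lambda>_. E)) \<and>
     (\<forall>y\<in>L. \<forall>v. field_shift y v \<in> L) \<and>
     (\<lambda>(y, v). field_shift y v) \<in> path_space E L \<Otimes>\<^sub>M borel \<rightarrow>\<^sub>M path_space E L"

definition stationary_field ::
  "'w measure \<Rightarrow> 'e measure \<Rightarrow> (real ^ 'd \<Rightarrow> 'e) set \<Rightarrow> ('w \<Rightarrow> real ^ 'd \<Rightarrow> 'e) \<Rightarrow> bool" where
  "stationary_field N E L Y \<longleftrightarrow>
     Y \<in> N \<rightarrow>\<^sub>M path_space E L \<and>
     (\<forall>v. distr N (path_space E L) (\<lambda>w. field_shift (Y w) v) = distr N (path_space E L) Y)"

definition field_point_map ::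
  "'e measure \<Rightarrow> (real ^ 'd \<Rightarrow> 'e) set \<Rightarrow> ((real ^ 'd) set \<times> (real ^ 'd \<Rightarrow> 'e) \<Rightarrow> real ^ 'd) \<Rightarrow> bool"
  where
  "field_point_map E L \<pi> \<longleftrightarrow>
     \<pi> \<in> configurations0 \<Otimes>\<^sub>M path_space E L \<rightarrow>\<^sub>M borel \<and>
     (\<forall>\<omega>\<in>space configurations0. \<forall>y\<in>L. \<pi> (\<omega>, y) \<in> \<omega>)"

definition field_point_shift ::
  "((real ^ 'd) set \<times> (real ^ 'd \<Rightarrow> 'e) \<Rightarrow> real ^ 'd) \<Rightarrow>
   (real ^ 'd) set \<times> (real ^ 'd \<Rightarrow> 'e) \<Rightarrow> (real ^ 'd) set \<times> (real ^ 'd \<Rightarrow> 'e)" where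
  "field_point_shift \<pi> = (\<lambda>(\<omega>, y). (config_shift \<omega> (\<pi> (\<omega>, y)), field_shift y (\<pi> (\<omega>, y))))"

text \<open>Two random elements are independent if the \<sigma>-algebras they generate are. (The library's
  \<open>indep_var\<close> requires both to take values in the same type.)\<close>

definition independent_elements ::
  "'w measure \<Rightarrow> 'b measure \<Rightarrow> ('w \<Rightarrow> 'b) \<Rightarrow> 'c measure \<Rightarrow> ('w \<Rightarrow> 'c) \<Rightarrow> bool" where
  "independent_elements N A X B Z \<longleftrightarrow>
     X \<in> N \<rightarrow>\<^sub>M A \<and> Z \<in> N \<rightarrow>\<^sub>M B \<and>
     prob_space.indep_set N (sets (vimage_algebra (space N) X A)) (sets (vimage_algebra (space N) Z B))"

text \<open>The field \<open>Y\<close> may need more randomness than the space \<open>M\<close> carrying \<open>S\<close> provides, so it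
  lives on an arbitrary probability space \<open>N\<close> together with a copy \<open>S'\<close> of \<open>S\<close>; this includes
  \<open>N = M\<close>, \<open>S' = S\<close>, and every extension of \<open>M\<close>. The types of the sample space \<open>N\<close> and of the
  field values cannot be bound by a quantifier, hence the two type arguments: point-stationarity
  proper is \<open>point_stationary TYPE('w) TYPE('e) M S\<close> for all types \<open>'w\<close> and \<open>'e\<close>.\<close>

definition point_stationary ::
  "'w itself \<Rightarrow> 'e itself \<Rightarrow> 'm measure \<Rightarrow> ('m \<Rightarrow> (real ^ 'd) set) \<Rightarrow> bool" where
  "point_stationary _ _ M S \<longleftrightarrow>
     (\<forall>(N :: 'w measure) (S' :: 'w \<Rightarrow> (real ^ 'd) set) (E :: 'e measure) L Y \<pi>.
        prob_space N \<longrightarrow>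
        S' \<in> N \<rightarrow>\<^sub>M configurations0 \<longrightarrow>
        distr N configurations0 S' = distr M configurations0 S \<longrightarrow>
        shift_measurable E L \<longrightarrow>
        stationary_field N E L Y \<longrightarrow>
        independent_elements N configurations0 S' (path_space E L) Y \<longrightarrow>
        field_point_map E L \<pi> \<longrightarrow>
        bij_betw (field_point_shift \<pi>) (space configurations0 \<times> L) (space configurations0 \<times> L) \<longrightarrow>
        distr N configurations0 (\<lambda>w. config_shift (S' w) (\<pi> (S' w, Y w))) =
          distr N configurations0 S')"

end

theory Submission
  imports Defs
begin

text \<open>
  Write \<open>\<mu>\<close> for the law of the configuration and \<open>\<nu>\<close> for the law of the field. Each point map
  \<open>\<pi> n\<close> of the enumeration also moves the field along, by
  \<open>\<tau> n (\<omega>, y) = (\<omega> - \<pi> n \<omega>, field_shift y (\<pi> n \<omega>))\<close>. For a fixed \<open>\<omega>\<close> the field is shifted by a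
  fixed vector, which does not change \<open>\<nu>\<close>, and the first component of \<open>\<tau> n\<close> preserves \<open>\<mu>\<close> by
  hypothesis. Hence \<open>\<tau> n\<close> preserves the joint law \<open>\<mu> \<Otimes>\<^sub>M \<nu>\<close> (\<open>distr_skew_product\<close>), and the relation
  \<open>\<pi> (- n) (\<omega> - \<pi> n \<omega>) = - \<pi> n \<omega>\<close> makes \<open>\<tau> (- n)\<close> the inverse of \<open>\<tau> n\<close>.

  Now let \<open>T\<close> be the point-shift of an arbitrary point map \<open>\<rho>\<close> that may look at the field. Almost
  every configuration is enumerated without repetition by the \<open>\<pi> n\<close>, so \<open>\<rho>\<close> picks the point
  \<open>\<pi> n \<omega>\<close> for exactly one \<open>n\<close>: the sets \<open>A n = {\<rho> = \<pi> n}\<close> partition the space up to a null set, and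
  \<open>T = \<tau> n\<close> on \<open>A n\<close>. Bijectivity of \<open>T\<close> makes the images \<open>\<tau> n ` A n\<close> partition the space as well.
  A map that is glued in this way from measure-preserving pieces preserves the measure
  (\<open>distr_piecewise_measure_preserving\<close>). So \<open>T\<close> preserves \<open>\<mu> \<Otimes>\<^sub>M \<nu>\<close> (\<open>distr_field_point_shift\<close>), and
  the first marginal of this invariance is point-stationarity.

  The \<sigma>-algebra on configurations only knows the counts in fixed bounded sets, whereas shifting by
  a random vector calls for counts in random sets. These are measurable by a Dynkin argument
  (\<open>measurable_card_section\<close>), which also yields the measurability of the event that the \<open>\<pi> n\<close>
  enumerate the configuration.
\<close>

section \<open>Configurations and their shifts\<close>

lemma space_configurations: "space configurations = {\<omega>. locally_finite \<omega>}"
  unfolding configurations_def by (rule space_measure_of) auto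

lemma space_configurations0: "space configurations0 = {\<omega>. locally_finite \<omega> \<and> 0 \<in> \<omega>}"
  by (auto simp: configurations0_def space_restrict_space space_configurations)

lemma locally_finite_config_shift:
  fixes \<omega> :: "(real ^ 'd) set"
  assumes "locally_finite \<omega>"
  shows "locally_finite (config_shift \<omega> x)"
  unfolding locally_finite_def
proof (intro allI impI)
  fix B :: "(real ^ 'd) set" assume "bounded B"
  then have "bounded ((\<lambda>s. s + x) ` B)"
    by (rule bounded_translation_minus[of _ "- x", simplified])
  then have "finite (\<omega> \<inter> (\<lambda>s. s + x) ` B)"
    using assms by (auto simp: locally_finite_def)
  then have "finite ((\<lambda>s. s - x) ` (\<omega> \<inter> (\<lambda>s. s + x) ` B))" by simp
  moreover have "config_shift \<omega> x \<inter> B \<subseteq> (\<lambda>s. s - x) ` (\<omega> \<inter> (\<lambda>s. s + x) ` B)"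
    unfolding config_shift_def by (force simp: image_iff)
  ultimately show "finite (config_shift \<omega> x \<inter> B)" by (rule finite_subset[rotated])
qed

lemma config_shift_minus: "config_shift (config_shift \<omega> x) (- x) = \<omega>"
  by (simp add: config_shift_def image_image)

lemma measurable_card_Int:
  fixes B :: "(real ^ 'd) set"
  assumes "B \<in> sets borel" "bounded B"
  shows "(\<lambda>\<omega>. card (\<omega> \<inter> B)) \<in> configurations \<rightarrow>\<^sub>M count_space UNIV"
proof (rule measurable_count_space_eq_countable[THEN iffD2], simp, intro conjI ballI)
  fix k :: nat
  have "(\<lambda>\<omega>. card (\<omega> \<inter> B)) -` {k} \<inter> space configurations
      = {\<omega>. locally_finite \<omega> \<and> card (\<omega> \<inter> B) = k}"
    by (auto simp: space_configurations)
  also have "\<dots> \<in> sets configurations"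
    unfolding configurations_def using assms by (intro in_measure_of) auto
  finally show "(\<lambda>\<omega>. card (\<omega> \<inter> B)) -` {k} \<inter> space configurations \<in> sets configurations" .
qed auto

lemma measurable_into_configurations:
  fixes g :: "'x \<Rightarrow> (real ^ 'd) set"
  assumes "\<And>z. z \<in> space X \<Longrightarrow> locally_finite (g z)"
    and "\<And>B. B \<in> sets borel \<Longrightarrow> bounded B \<Longrightarrow>
      (\<lambda>z. card (g z \<inter> B)) \<in> X \<rightarrow>\<^sub>M count_space UNIV"
  shows "g \<in> X \<rightarrow>\<^sub>M configurations"
  unfolding configurations_def
proof (rule measurable_measure_of)
  fix A :: "(real ^ 'd) set set"
  assume "A \<in> {{\<omega>. locally_finite \<omega> \<and> card (\<omega> \<inter> B) = k} |B k. B \<in> sets borel \<and> bounded B}"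
  then obtain B k where A: "A = {\<omega>. locally_finite \<omega> \<and> card (\<omega> \<inter> B) = k}"
    and B: "B \<in> sets borel" "bounded B" by auto
  have "g -` A \<inter> space X = (\<lambda>z. card (g z \<inter> B)) -` {k} \<inter> space X"
    using assms(1) by (auto simp: A)
  also have "\<dots> \<in> sets X"
    by (rule measurable_sets[OF assms(2)[OF B]]) simp
  finally show "g -` A \<inter> space X \<in> sets X" .
qed (use assms(1) in auto)

section \<open>Measurability of random counts and random shifts\<close>

text \<open>For a measurable rectangle \<open>D\<close> the section is empty or a fixed Borel set, and such counts are
  measurable by the choice of the \<sigma>-algebra; the rest is Dynkin's theorem. The ball keeps all
  counts finite, which complements need, and values in \<open>ennreal\<close> allow countable disjoint unions.\<close>

lemma measurable_emeasure_count_section: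
  fixes g :: "'x \<Rightarrow> (real ^ 'd) set"
  assumes g: "g \<in> X \<rightarrow>\<^sub>M configurations"
    and D: "D \<in> sets (X \<Otimes>\<^sub>M borel)"
  shows "(\<lambda>z. emeasure (count_space UNIV) (g z \<inter> Pair z -` D \<inter> ball 0 r)) \<in> borel_measurable X"
proof -
  let ?c = "\<lambda>D z. emeasure (count_space UNIV) (g z \<inter> Pair z -` D \<inter> ball 0 r)"
  have fin: "finite (g z \<inter> ball 0 r)" if "z \<in> space X" for z
    using measurable_space[OF g that] by (auto simp: space_configurations locally_finite_def)
  have count: "(\<lambda>z. emeasure (count_space UNIV) (g z \<inter> (b \<inter> ball 0 r))) \<in> borel_measurable X"
    if b: "b \<in> sets borel" for b :: "(real ^ 'd) set"
  proof -
    have "(\<lambda>z. of_nat (card (g z \<inter> (b \<inter> ball 0 r))) :: ennreal) \<in> borel_measurable X"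
      by (rule measurable_compose[OF measurable_compose[OF g measurable_card_Int]])
        (use b in \<open>auto intro: bounded_subset[OF bounded_ball]\<close>)
    then show ?thesis
      by (rule measurable_cong[THEN iffD1, rotated])
        (auto intro!: emeasure_count_space_finite[symmetric] intro: finite_subset[OF _ fin])
  qed
  have "D \<in> sigma_sets (space X \<times> space borel) {a \<times> b |a b. a \<in> sets X \<and> b \<in> sets borel}"
    using D by (simp add: sets_pair_measure)
  with Int_stable_pair_measure_generator pair_measure_closed show ?thesis
  proof (induction D rule: sigma_sets_induct_disjoint)
    case (basic A)
    then obtain a b where A: "A = a \<times> b" and a[measurable]: "a \<in> sets X" and b: "b \<in> sets borel"
      by auto
    have "?c A = (\<lambda>z. if z \<in> a then emeasure (count_space UNIV) (g z \<inter> (b \<inter> ball 0 r)) else 0)"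
      by (auto simp: A fun_eq_iff Int_assoc vimage_def)
    then show ?case
      using measurable_If_set[OF count[OF b] measurable_const[of 0], of a] a by simp
  next
    case empty
    then show ?case by simp
  next
    case (compl A)
    have "?c (space X \<times> space borel - A) z
        = emeasure (count_space UNIV) (g z \<inter> (UNIV \<inter> ball 0 r)) - ?c A z" if z: "z \<in> space X" for z
    proof -
      have "g z \<inter> Pair z -` (space X \<times> space borel - A) \<inter> ball 0 r
          = g z \<inter> (UNIV \<inter> ball 0 r) - g z \<inter> Pair z -` A \<inter> ball 0 r"
        using z by auto
      then show ?thesis
        using finite_subset[OF _ fin[OF z], of "g z \<inter> Pair z -` A \<inter> ball 0 r", OF Int_mono]
        by (simp only:, intro emeasure_Diff) (auto simp: emeasure_count_space_finite)
    qed
    then show ?case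
      using borel_measurable_minus_ennreal[OF count[of UNIV] compl.IH]
      by (subst measurable_cong) auto
  next
    case (union A)
    have "?c (\<Union> (range A)) z = (\<Sum>i. ?c (A i) z)" for z
    proof -
      have "(\<Sum>i. ?c (A i) z) = emeasure (count_space UNIV) (\<Union>i. g z \<inter> Pair z -` A i \<inter> ball 0 r)"
        using union.hyps by (intro suminf_emeasure) (auto simp: disjoint_family_on_def)
      also have "(\<Union>i. g z \<inter> Pair z -` A i \<inter> ball 0 r) = g z \<inter> Pair z -` (\<Union> (range A)) \<inter> ball 0 r"
        by auto
      finally show ?thesis ..
    qed
    then show ?case
      using union.IH by (simp only: borel_measurable_suminf_order)
  qed
qed

lemma measurable_card_section:
  fixes g :: "'x \<Rightarrow> (real ^ 'd) set"
  assumes g: "g \<in> X \<rightarrow>\<^sub>M configurations"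
    and D: "D \<in> sets (X \<Otimes>\<^sub>M borel)"
  shows "(\<lambda>z. card (g z \<inter> Pair z -` D \<inter> ball 0 r)) \<in> X \<rightarrow>\<^sub>M count_space UNIV"
proof (rule measurable_count_space_eq_countable[THEN iffD2], simp, intro conjI ballI)
  fix k :: nat
  let ?c = "\<lambda>z. emeasure (count_space UNIV) (g z \<inter> Pair z -` D \<inter> ball 0 r)"
  have "?c z = of_nat (card (g z \<inter> Pair z -` D \<inter> ball 0 r))" if "z \<in> space X" for z
    using measurable_space[OF g that]
    by (intro emeasure_count_space_finite)
      (auto simp: space_configurations locally_finite_def intro: finite_subset[of _ "g z \<inter> ball 0 r"])
  then have "(\<lambda>z. card (g z \<inter> Pair z -` D \<inter> ball 0 r)) -` {k} \<inter> space X
      = ?c -` {of_nat k} \<inter> space X"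
    by auto
  also have "\<dots> \<in> sets X"
    by (rule measurable_sets[OF measurable_emeasure_count_section[OF g D]]) simp
  finally show "(\<lambda>z. card (g z \<inter> Pair z -` D \<inter> ball 0 r)) -` {k} \<inter> space X \<in> sets X" .
qed auto

text \<open>The points of \<open>g z - x z\<close> in \<open>B\<close> correspond to those of \<open>g z\<close> in the random set \<open>B + x z\<close>, which
  is a section of the measurable set \<open>{(z, s). s - x z \<in> B}\<close>.\<close>

lemma measurable_config_shift:
  fixes g :: "'x \<Rightarrow> (real ^ 'd) set"
  assumes g: "g \<in> X \<rightarrow>\<^sub>M configurations" and x: "x \<in> borel_measurable X"
  shows "(\<lambda>z. config_shift (g z) (x z)) \<in> X \<rightarrow>\<^sub>M configurations"
proof (rule measurable_into_configurations)
  fix z assume "z \<in> space X"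
  then show "locally_finite (config_shift (g z) (x z))"
    using measurable_space[OF g] by (auto simp: space_configurations locally_finite_config_shift)
next
  fix B :: "(real ^ 'd) set" assume B: "B \<in> sets borel" "bounded B"
  obtain R where R: "\<And>b. b \<in> B \<Longrightarrow> norm b \<le> R"
    using B(2) by (auto simp: bounded_iff)
  define D where "D = {p \<in> space (X \<Otimes>\<^sub>M borel). snd p - x (fst p) \<in> B}"
  have [measurable]: "D \<in> sets (X \<Otimes>\<^sub>M borel)"
    unfolding D_def using x B(1) by measurable
  \<comment> \<open>The random radius confines \<open>B + x z\<close> to a ball; it takes only countably many values, so it
    can be frozen when measurability is checked.\<close>
  have eq: "card (config_shift (g z) (x z) \<inter> B)
      = card (g z \<inter> Pair z -` D \<inter> ball 0 (real (nat \<lceil>norm (x z)\<rceil>) + R + 1))"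
    if z: "z \<in> space X" for z
  proof -
    have "norm s < real (nat \<lceil>norm (x z)\<rceil>) + R + 1" if "s - x z \<in> B" for s
      using R[OF that] norm_triangle_ineq[of "s - x z" "x z"] by simp linarith
    then have "config_shift (g z) (x z) \<inter> B
        = (\<lambda>s. s - x z) ` (g z \<inter> Pair z -` D \<inter> ball 0 (real (nat \<lceil>norm (x z)\<rceil>) + R + 1))"
      using z by (auto simp: config_shift_def D_def space_pair_measure)
    then show ?thesis
      by (simp add: card_image inj_on_def)
  qed
  have "(\<lambda>z. card (g z \<inter> Pair z -` D \<inter> ball 0 (real (nat \<lceil>norm (x z)\<rceil>) + R + 1)))
      \<in> X \<rightarrow>\<^sub>M count_space UNIV"
  proof (rule measurable_compose_countable
      [where f = "\<lambda>k z. card (g z \<inter> Pair z -` D \<inter> ball 0 (real k + R + 1))"])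
    show "(\<lambda>z. nat \<lceil>norm (x z)\<rceil>) \<in> X \<rightarrow>\<^sub>M count_space UNIV"
      using x by measurable
  qed (intro measurable_card_section g \<open>D \<in> _\<close>)
  then show "(\<lambda>z. card (config_shift (g z) (x z) \<inter> B)) \<in> X \<rightarrow>\<^sub>M count_space UNIV"
    by (rule measurable_cong[THEN iffD2, rotated]) (rule eq)
qed

lemma measurable_configurations0D:
  "g \<in> X \<rightarrow>\<^sub>M configurations0 \<Longrightarrow> g \<in> X \<rightarrow>\<^sub>M configurations"
  unfolding configurations0_def by (rule measurable_restrict_space2_iff[THEN iffD1, THEN conjunct1])

lemma measurable_config_shift0:
  fixes g :: "'x \<Rightarrow> (real ^ 'd) set"
  assumes g: "g \<in> X \<rightarrow>\<^sub>M configurations0" and x: "x \<in> borel_measurable X"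
    and in_g: "\<And>z. z \<in> space X \<Longrightarrow> x z \<in> g z"
  shows "(\<lambda>z. config_shift (g z) (x z)) \<in> X \<rightarrow>\<^sub>M configurations0"
  unfolding configurations0_def
  by (rule measurable_restrict_space2)
    (use in_g measurable_config_shift[OF measurable_configurations0D[OF g] x]
     in \<open>auto simp: config_shift_def\<close>)

text \<open>Being contained in the range of the \<open>p n\<close> quantifies over the uncountably many potential points
  of \<open>\<omega>\<close>. It becomes a countable condition by asking that no ball of integer radius contain a point
  of \<open>\<omega>\<close> missed by all \<open>p n\<close>. This measurability is what lets the hypothesis on a particular
  process be read as one on its law, and hence on every copy of the process.\<close>

lemma sets_enumerated_configurations:
  fixes p :: "int \<Rightarrow> (real ^ 'd) set \<Rightarrow> real ^ 'd"
  assumes p: "\<And>n. point_map (p n)"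
  shows "{\<omega> \<in> space configurations0. inj (\<lambda>n. p n \<omega>) \<and> \<omega> = range (\<lambda>n. p n \<omega>)}
    \<in> sets configurations0"
proof -
  let ?C = "configurations0 :: (real ^ 'd) set measure"
  have [measurable]: "p n \<in> borel_measurable ?C" for n
    using p by (simp add: point_map_def)
  define D where "D = {q \<in> space (?C \<Otimes>\<^sub>M borel). \<forall>n. snd q \<noteq> p n (fst q)}"
  have D: "D \<in> sets (?C \<Otimes>\<^sub>M borel)"
    unfolding D_def by measurable
  have [measurable]: "(\<lambda>\<omega>. card (\<omega> \<inter> Pair \<omega> -` D \<inter> ball 0 (real k))) \<in> ?C \<rightarrow>\<^sub>M count_space UNIV" for k
    by (intro measurable_card_section measurable_configurations0D measurable_ident_sets refl D)
  have "\<omega> = range (\<lambda>n. p n \<omega>) \<longleftrightarrow> (\<forall>k. card (\<omega> \<inter> Pair \<omega> -` D \<inter> ball 0 (real k)) = 0)"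
    if \<omega>: "\<omega> \<in> space ?C" for \<omega>
  proof
    assume "\<omega> = range (\<lambda>n. p n \<omega>)"
    then have "\<omega> \<inter> Pair \<omega> -` D = {}" by (auto simp: D_def)
    then show "\<forall>k. card (\<omega> \<inter> Pair \<omega> -` D \<inter> ball 0 (real k)) = 0" by simp
  next
    assume *: "\<forall>k. card (\<omega> \<inter> Pair \<omega> -` D \<inter> ball 0 (real k)) = 0"
    have "s \<in> range (\<lambda>n. p n \<omega>)" if s: "s \<in> \<omega>" for s
    proof (rule ccontr)
      assume "s \<notin> range (\<lambda>n. p n \<omega>)"
      moreover obtain k where "norm s < real k" using reals_Archimedean2 by blast
      ultimately have "s \<in> \<omega> \<inter> Pair \<omega> -` D \<inter> ball 0 (real k)"
        using s \<omega> by (auto simp: D_def space_pair_measure)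
      moreover have "finite (\<omega> \<inter> Pair \<omega> -` D \<inter> ball 0 (real k))"
        using \<omega> by (auto simp: space_configurations0 locally_finite_def
            intro: finite_subset[of _ "\<omega> \<inter> ball 0 (real k)"])
      ultimately show False using *[rule_format, of k] by (metis card_0_eq empty_iff)
    qed
    then show "\<omega> = range (\<lambda>n. p n \<omega>)" using p \<omega> by (auto simp: point_map_def)
  qed
  then have "{\<omega> \<in> space ?C. inj (\<lambda>n. p n \<omega>) \<and> \<omega> = range (\<lambda>n. p n \<omega>)}
    = {\<omega> \<in> space ?C. (\<forall>i j. p i \<omega> = p j \<omega> \<longrightarrow> i = j) \<and>
        (\<forall>k. card (\<omega> \<inter> Pair \<omega> -` D \<inter> ball 0 (real k)) = 0)}"
    by (auto simp: inj_on_def)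
  also have "\<dots> \<in> sets ?C" by measurable
  finally show ?thesis .
qed

section \<open>Measure-preserving maps and product laws\<close>

text \<open>Since \<open>\<theta>' i\<close> undoes \<open>\<theta> i\<close>, invariance under \<open>\<theta> i\<close> turns the integral of \<open>f \<circ> \<theta> i\<close> over \<open>A i\<close> into
  that of \<open>f\<close> over \<open>{z. \<theta>' i z \<in> A i}\<close>. Both families of sets partition the space up to null sets, so
  summation over \<open>i\<close> gives the integral of \<open>f \<circ> T\<close> on one side and that of \<open>f\<close> on the other. Using
  the sets \<open>{z. \<theta>' i z \<in> A i}\<close> instead of the images \<open>\<theta> i ` A i\<close> avoids any question about the
  measurability of images or of an inverse of \<open>T\<close>.\<close>

lemma distr_piecewise_measure_preserving:
  fixes \<theta> \<theta>' :: "'i::countable \<Rightarrow> 'a \<Rightarrow> 'a"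
  assumes \<theta>: "\<And>i. \<theta> i \<in> P \<rightarrow>\<^sub>M P" and \<theta>': "\<And>i. \<theta>' i \<in> P \<rightarrow>\<^sub>M P"
    and inv: "\<And>i z. z \<in> space P \<Longrightarrow> \<theta>' i (\<theta> i z) = z"
    and pres: "\<And>i. distr P P (\<theta> i) = P"
    and T: "T \<in> P \<rightarrow>\<^sub>M P"
    and A: "\<And>i. A i \<in> sets P"
    and T_eq: "\<And>i z. z \<in> A i \<Longrightarrow> T z = \<theta> i z"
    and dom: "AE z in P. \<exists>!i. z \<in> A i"
    and ran: "AE z in P. \<exists>!i. \<theta>' i z \<in> A i"
  shows "distr P P T = P"
proof (rule measure_eqI)
  fix F assume "F \<in> sets (distr P P T)"
  then have F: "F \<in> sets P" by simp
  let ?I = "count_space (UNIV :: 'i set)"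
  have one: "(\<integral>\<^sup>+i. indicator {i. Q i} i \<partial>?I) = 1" if "\<exists>!i. Q i" for Q :: "'i \<Rightarrow> bool"
  proof -
    from that obtain j where "{i. Q i} = {j}" by blast
    then show ?thesis by (simp add: emeasure_count_space_finite)
  qed
  note [measurable] = \<theta> \<theta>' T A F
  have "emeasure (distr P P T) F = (\<integral>\<^sup>+z. indicator F (T z) \<partial>P)"
    by (subst nn_integral_indicator[symmetric], simp, subst nn_integral_distr) simp_all
  also have "\<dots> = (\<integral>\<^sup>+z. (\<integral>\<^sup>+i. indicator (A i) z * indicator F (\<theta> i z) \<partial>?I) \<partial>P)"
  proof (rule nn_integral_cong_AE, use dom in eventually_elim)
    fix z assume ex: "\<exists>!i. z \<in> A i"
    have "(\<integral>\<^sup>+i. indicator (A i) z * indicator F (\<theta> i z) \<partial>?I)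
        = (\<integral>\<^sup>+i. indicator F (T z) * indicator {i. z \<in> A i} i \<partial>?I)"
      by (rule nn_integral_cong) (auto simp: indicator_def T_eq)
    also have "\<dots> = indicator F (T z)"
      using one[OF ex] by (simp add: nn_integral_cmult)
    finally show "indicator F (T z) = (\<integral>\<^sup>+i. indicator (A i) z * indicator F (\<theta> i z) \<partial>?I)" ..
  qed
  also have "\<dots> = (\<integral>\<^sup>+i. (\<integral>\<^sup>+z. indicator (A i) z * indicator F (\<theta> i z) \<partial>P) \<partial>?I)"
    by (rule nn_integral_count_space_nn_integral) measurable
  also have "\<dots> = (\<integral>\<^sup>+i. (\<integral>\<^sup>+z. indicator (A i) (\<theta>' i z) * indicator F z \<partial>P) \<partial>?I)"
  proof (rule nn_integral_cong)
    fix i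
    have "(\<integral>\<^sup>+z. indicator (A i) (\<theta>' i z) * indicator F z \<partial>P)
        = (\<integral>\<^sup>+z. indicator (A i) (\<theta>' i z) * indicator F z \<partial>distr P P (\<theta> i))"
      by (simp add: pres)
    also have "\<dots> = (\<integral>\<^sup>+z. indicator (A i) (\<theta>' i (\<theta> i z)) * indicator F (\<theta> i z) \<partial>P)"
      by (rule nn_integral_distr) measurable
    also have "\<dots> = (\<integral>\<^sup>+z. indicator (A i) z * indicator F (\<theta> i z) \<partial>P)"
      by (rule nn_integral_cong) (simp add: inv)
    finally show "(\<integral>\<^sup>+z. indicator (A i) z * indicator F (\<theta> i z) \<partial>P)
        = (\<integral>\<^sup>+z. indicator (A i) (\<theta>' i z) * indicator F z \<partial>P)" ..
  qed
  also have "\<dots> = (\<integral>\<^sup>+z. (\<integral>\<^sup>+i. indicator (A i) (\<theta>' i z) * indicator F z \<partial>?I) \<partial>P)"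
    by (rule nn_integral_count_space_nn_integral[symmetric]) measurable
  also have "\<dots> = (\<integral>\<^sup>+z. indicator F z \<partial>P)"
  proof (rule nn_integral_cong_AE, use ran in eventually_elim)
    fix z assume ex: "\<exists>!i. \<theta>' i z \<in> A i"
    have "(\<integral>\<^sup>+i. indicator (A i) (\<theta>' i z) * indicator F z \<partial>?I)
        = (\<integral>\<^sup>+i. indicator F z * indicator {i. \<theta>' i z \<in> A i} i \<partial>?I)"
      by (rule nn_integral_cong) (auto simp: indicator_def)
    also have "\<dots> = indicator F z"
      using one[OF ex] by (simp add: nn_integral_cmult)
    finally show "(\<integral>\<^sup>+i. indicator (A i) (\<theta>' i z) * indicator F z \<partial>?I) = indicator F z" .
  qed
  finally show "emeasure (distr P P T) F = emeasure P F" by (simp add: F)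
qed simp

text \<open>By Fubini, integrate the second coordinate first: with \<open>a\<close> held fixed, \<open>\<tau> a\<close> drops out by the
  invariance of \<open>B\<close>, and then \<open>\<theta>\<close> drops out by the invariance of \<open>A\<close>.\<close>

lemma distr_skew_product:
  assumes "prob_space A" "prob_space B"
    and \<theta>: "\<theta> \<in> A \<rightarrow>\<^sub>M A" "distr A A \<theta> = A"
    and \<tau>: "(\<lambda>(a, b). \<tau> a b) \<in> A \<Otimes>\<^sub>M B \<rightarrow>\<^sub>M B" "\<And>a. a \<in> space A \<Longrightarrow> distr B B (\<tau> a) = B"
  shows "distr (A \<Otimes>\<^sub>M B) (A \<Otimes>\<^sub>M B) (\<lambda>(a, b). (\<theta> a, \<tau> a b)) = A \<Otimes>\<^sub>M B"
proof (rule measure_eqI)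
  interpret A: prob_space A by fact
  interpret B: prob_space B by fact
  interpret pair_sigma_finite A B ..
  note [measurable] = \<theta>(1) \<tau>(1)
  have \<tau>'[measurable]: "\<tau> a \<in> B \<rightarrow>\<^sub>M B" if "a \<in> space A" for a
    using measurable_compose[OF measurable_Pair1'[OF that] \<tau>(1)] by simp
  have map[measurable]: "(\<lambda>(a, b). (\<theta> a, \<tau> a b)) \<in> A \<Otimes>\<^sub>M B \<rightarrow>\<^sub>M A \<Otimes>\<^sub>M B"
    by measurable
  fix F assume "F \<in> sets (distr (A \<Otimes>\<^sub>M B) (A \<Otimes>\<^sub>M B) (\<lambda>(a, b). (\<theta> a, \<tau> a b)))"
  then have F[measurable]: "F \<in> sets (A \<Otimes>\<^sub>M B)" by simp
  have "emeasure (distr (A \<Otimes>\<^sub>M B) (A \<Otimes>\<^sub>M B) (\<lambda>(a, b). (\<theta> a, \<tau> a b))) F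
      = (\<integral>\<^sup>+z. indicator F (\<theta> (fst z), \<tau> (fst z) (snd z)) \<partial>(A \<Otimes>\<^sub>M B))"
    by (subst nn_integral_indicator[symmetric], simp, subst nn_integral_distr)
      (auto simp: case_prod_beta' intro!: nn_integral_cong)
  also have "\<dots> = (\<integral>\<^sup>+a. \<integral>\<^sup>+b. indicator F (\<theta> a, \<tau> a b) \<partial>B \<partial>A)"
    using map by (subst B.nn_integral_fst[symmetric]) (auto simp: case_prod_beta')
  also have "\<dots> = (\<integral>\<^sup>+a. \<integral>\<^sup>+b. indicator F (\<theta> a, b) \<partial>B \<partial>A)"
  proof (rule nn_integral_cong)
    fix a assume a: "a \<in> space A"
    have \<theta>a: "\<theta> a \<in> space A" using a \<theta>(1) by (rule measurable_space[rotated])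
    have "(\<integral>\<^sup>+b. indicator F (\<theta> a, \<tau> a b) \<partial>B) = (\<integral>\<^sup>+b. indicator F (\<theta> a, b) \<partial>distr B B (\<tau> a))"
      using a \<theta>a by (subst nn_integral_distr) auto
    then show "(\<integral>\<^sup>+b. indicator F (\<theta> a, \<tau> a b) \<partial>B) = (\<integral>\<^sup>+b. indicator F (\<theta> a, b) \<partial>B)"
      by (simp add: \<tau>(2)[OF a])
  qed
  also have "\<dots> = (\<integral>\<^sup>+a. \<integral>\<^sup>+b. indicator F (a, b) \<partial>B \<partial>distr A A \<theta>)"
    by (subst nn_integral_distr) measurable
  also have "\<dots> = emeasure (A \<Otimes>\<^sub>M B) F"
    by (simp add: \<theta>(2) B.nn_integral_fst)
  finally show "emeasure (distr (A \<Otimes>\<^sub>M B) (A \<Otimes>\<^sub>M B) (\<lambda>(a, b). (\<theta> a, \<tau> a b))) F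
    = emeasure (A \<Otimes>\<^sub>M B) F" .
qed simp

lemma distr_Pair_independent_elements:
  assumes "prob_space N" and ind: "independent_elements N A X B Z"
  shows "distr N (A \<Otimes>\<^sub>M B) (\<lambda>w. (X w, Z w)) = distr N A X \<Otimes>\<^sub>M distr N B Z"
proof -
  interpret N: prob_space N by fact
  have X[measurable]: "X \<in> N \<rightarrow>\<^sub>M A" and Z[measurable]: "Z \<in> N \<rightarrow>\<^sub>M B"
    using ind by (auto simp: independent_elements_def)
  interpret X: prob_space "distr N A X" by (rule N.prob_space_distr[OF X])
  interpret Z: prob_space "distr N B Z" by (rule N.prob_space_distr[OF Z])
  have "distr N A X \<Otimes>\<^sub>M distr N B Z = distr N (A \<Otimes>\<^sub>M B) (\<lambda>w. (X w, Z w))"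
  proof (rule pair_measure_eqI)
    fix a b assume "a \<in> sets (distr N A X)" "b \<in> sets (distr N B Z)"
    then have [measurable]: "a \<in> sets A" "b \<in> sets B" by auto
    have "N.prob ((X -` a \<inter> space N) \<inter> (Z -` b \<inter> space N))
        = N.prob (X -` a \<inter> space N) * N.prob (Z -` b \<inter> space N)"
      using ind unfolding independent_elements_def
      by (intro N.indep_setD) (auto intro!: in_vimage_algebra)
    moreover have "(X -` a \<inter> space N) \<inter> (Z -` b \<inter> space N)
        = (\<lambda>w. (X w, Z w)) -` (a \<times> b) \<inter> space N"
      by auto
    ultimately show "emeasure (distr N A X) a * emeasure (distr N B Z) b
        = emeasure (distr N (A \<Otimes>\<^sub>M B) (\<lambda>w. (X w, Z w))) (a \<times> b)"
      by (simp add: emeasure_distr N.emeasure_eq_measure ennreal_mult')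
  qed (auto intro: X.sigma_finite_measure_axioms Z.sigma_finite_measure_axioms cong: sets_pair_measure_cong)
  then show ?thesis ..
qed
section \<open>Point-shifts that depend on a stationary field\<close>

text \<open>The core of the argument, for the law \<open>\<mu>\<close> of the configuration and the law \<open>\<nu>\<close> of the field. The
  invariance concerns the joint law and not just its first marginal, because the gluing of the pieces
  takes place on pairs: it is on pairs that the point-shift is a bijection.\<close>

lemma distr_field_point_shift:
  fixes E :: "'e measure" and L :: "(real ^ 'd \<Rightarrow> 'e) set"
    and \<mu> :: "(real ^ 'd) set measure" and \<nu> :: "(real ^ 'd \<Rightarrow> 'e) measure"
    and p :: "int \<Rightarrow> (real ^ 'd) set \<Rightarrow> real ^ 'd"
    and \<pi> :: "(real ^ 'd) set \<times> (real ^ 'd \<Rightarrow> 'e) \<Rightarrow> real ^ 'd"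
  assumes \<mu>: "prob_space \<mu>" "sets \<mu> = sets configurations0"
    and \<nu>: "prob_space \<nu>" "sets \<nu> = sets (path_space E L)"
    and L: "shift_measurable E L"
    and \<nu>_shift: "\<And>v. distr \<nu> (path_space E L) (\<lambda>y. field_shift y v) = \<nu>"
    and p: "\<And>n. point_map (p n)"
    and p_inv: "\<And>n \<omega>. \<omega> \<in> space configurations0 \<Longrightarrow> p (- n) (point_shift (p n) \<omega>) = - p n \<omega>"
    and enum: "AE \<omega> in \<mu>. inj (\<lambda>n. p n \<omega>) \<and> \<omega> = range (\<lambda>n. p n \<omega>)"
    and \<mu>_shift: "\<And>n. distr \<mu> configurations0 (point_shift (p n)) = \<mu>"
    and \<pi>: "field_point_map E L \<pi>"
    and bij: "bij_betw (field_point_shift \<pi>) (space configurations0 \<times> L) (space configurations0 \<times> L)"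
  shows "field_point_shift \<pi> \<in> \<mu> \<Otimes>\<^sub>M \<nu> \<rightarrow>\<^sub>M \<mu> \<Otimes>\<^sub>M \<nu>" (is ?meas)
    and "distr (\<mu> \<Otimes>\<^sub>M \<nu>) (\<mu> \<Otimes>\<^sub>M \<nu>) (field_point_shift \<pi>) = \<mu> \<Otimes>\<^sub>M \<nu>" (is ?pres)
proof -
  let ?P = "\<mu> \<Otimes>\<^sub>M \<nu>"
  let ?T = "field_point_shift \<pi>"
  interpret \<mu>: prob_space \<mu> by fact
  interpret \<nu>: prob_space \<nu> by fact
  have space_L: "space (path_space E L) = L"
    using L by (auto simp: shift_measurable_def path_space_def space_restrict_space)
  have space_P: "space ?P = space configurations0 \<times> L"
    by (simp add: space_pair_measure sets_eq_imp_space_eq[OF \<mu>(2)] sets_eq_imp_space_eq[OF \<nu>(2)] space_L)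
  have space_\<mu>: "space \<mu> = space configurations0" by (rule sets_eq_imp_space_eq[OF \<mu>(2)])
  have space_\<nu>: "space \<nu> = L" using sets_eq_imp_space_eq[OF \<nu>(2)] space_L by simp
  have sets_P: "sets ?P = sets (configurations0 \<Otimes>\<^sub>M path_space E L)"
    by (intro sets_pair_measure_cong \<mu> \<nu>)
  have p_meas: "p n \<in> borel_measurable \<mu>" for n
    using p[of n] by (simp add: point_map_def measurable_cong_sets[OF \<mu>(2) refl])
  have p_in: "p n \<omega> \<in> \<omega>" if "\<omega> \<in> space configurations0" for n \<omega>
    using p that by (auto simp: point_map_def)
  have \<pi>_meas: "\<pi> \<in> borel_measurable ?P"
    using \<pi> by (simp add: field_point_map_def measurable_cong_sets[OF sets_P refl])
  have \<pi>_in: "\<pi> (\<omega>, y) \<in> \<omega>" if "(\<omega>, y) \<in> space ?P" for \<omega> y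
    using \<pi> that by (auto simp: field_point_map_def space_P)
  have id0: "(\<lambda>\<omega>. \<omega>) \<in> \<mu> \<rightarrow>\<^sub>M configurations0"
    by (rule measurable_ident_sets[OF \<mu>(2)])
  have shift_meas: "(\<lambda>z. field_shift (snd z) (f z)) \<in> ?P \<rightarrow>\<^sub>M \<nu>" if "f \<in> borel_measurable ?P" for f
  proof -
    have "(\<lambda>z. (snd z, f z)) \<in> ?P \<rightarrow>\<^sub>M path_space E L \<Otimes>\<^sub>M borel"
      using that measurable_snd[of \<mu> \<nu>]
      by (intro measurable_Pair) (simp_all add: measurable_cong_sets[OF refl \<nu>(2)])
    moreover have "(\<lambda>(y, v). field_shift y v) \<in> path_space E L \<Otimes>\<^sub>M borel \<rightarrow>\<^sub>M path_space E L"
      using L by (simp add: shift_measurable_def)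
    ultimately show ?thesis
      by (simp add: measurable_cong_sets[OF refl \<nu>(2)])
  qed

  define \<tau> where "\<tau> = (\<lambda>n (\<omega>, y). (point_shift (p n) \<omega>, field_shift (y :: real ^ 'd \<Rightarrow> 'e) (p n \<omega>)))"
  have \<tau>: "\<tau> n (\<omega>, y) = (point_shift (p n) \<omega>, field_shift y (p n \<omega>))" for n \<omega> y
    by (simp add: \<tau>_def)
  have pshift_meas: "point_shift (p n) \<in> \<mu> \<rightarrow>\<^sub>M \<mu>" for n
    using measurable_config_shift0[OF id0 p_meas p_in, of n]
    by (simp add: point_shift_def[abs_def] measurable_cong_sets[OF refl \<mu>(2)] space_\<mu>)
  have pfield_meas: "(\<lambda>(\<omega>, y). field_shift y (p n \<omega>)) \<in> ?P \<rightarrow>\<^sub>M \<nu>" for n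
    using shift_meas[OF measurable_compose[OF measurable_fst p_meas], of n]
    by (simp add: case_prod_beta')
  have \<tau>_meas: "\<tau> n \<in> ?P \<rightarrow>\<^sub>M ?P" for n
    unfolding \<tau>_def
    using measurable_compose[OF measurable_fst pshift_meas] pfield_meas[of n]
    by (auto simp: case_prod_beta' intro!: measurable_Pair)
  have \<tau>_pres: "distr ?P ?P (\<tau> n) = ?P" for n
    unfolding \<tau>_def
  proof (rule distr_skew_product[OF \<mu>(1) \<nu>(1) pshift_meas _ pfield_meas])
    show "distr \<mu> \<mu> (point_shift (p n)) = \<mu>"
      by (rule trans[OF distr_cong[OF refl \<mu>(2) refl] \<mu>_shift])
    show "distr \<nu> \<nu> (\<lambda>y. field_shift y (p n \<omega>)) = \<nu>" for \<omega>
      by (rule trans[OF distr_cong[OF refl \<nu>(2) refl] \<nu>_shift])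
  qed
  have \<tau>_inv: "\<tau> (- n) (\<tau> n z) = z" if "z \<in> space ?P" for n z
  proof -
    obtain \<omega> y where z: "z = (\<omega>, y)" "\<omega> \<in> space configurations0"
      using \<open>z \<in> space ?P\<close> by (auto simp: space_P)
    have "point_shift (p (- n)) (point_shift (p n) \<omega>) = config_shift (point_shift (p n) \<omega>) (- p n \<omega>)"
      by (subst point_shift_def) (simp add: p_inv z)
    also have "\<dots> = \<omega>"
      by (simp add: point_shift_def config_shift_minus)
    finally show ?thesis
      by (simp add: z \<tau> p_inv) (simp add: field_shift_def)
  qed

  define A where "A = (\<lambda>n. {z \<in> space ?P. \<pi> z = p n (fst z)})"
  have A_sets: "A n \<in> sets ?P" for n
  proof -
    note [measurable] = \<pi>_meas p_meas
    show ?thesis unfolding A_def by measurable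
  qed
  have T_eq: "?T z = \<tau> n z" if "z \<in> A n" for n z
    using that by (cases z) (simp add: A_def field_point_shift_def \<tau> point_shift_def)
  have T_meas: ?meas
  proof -
    have "(\<lambda>z. config_shift (fst z) (\<pi> z)) \<in> ?P \<rightarrow>\<^sub>M configurations0"
      using \<pi>_in by (intro measurable_config_shift0 measurable_compose[OF measurable_fst id0] \<pi>_meas) auto
    then show ?thesis
      using shift_meas[OF \<pi>_meas]
      by (auto simp: field_point_shift_def case_prod_beta' measurable_cong_sets[OF refl \<mu>(2)]
          intro!: measurable_Pair)
  qed
  have enum_P: "AE z in ?P. z \<in> space ?P \<and> inj (\<lambda>n. p n (fst z)) \<and> fst z = range (\<lambda>n. p n (fst z))"
  proof -
    have distr_fst: "distr ?P \<mu> fst = \<mu>" by (rule \<nu>.distr_pair_fst)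
    have "AE \<omega> in distr ?P \<mu> fst. inj (\<lambda>n. p n \<omega>) \<and> \<omega> = range (\<lambda>n. p n \<omega>)"
      using enum by (simp only: distr_fst)
    then have "AE z in ?P. inj (\<lambda>n. p n (fst z)) \<and> fst z = range (\<lambda>n. p n (fst z))"
      by (rule AE_distrD[rotated]) simp
    then show ?thesis using AE_space by eventually_elim blast
  qed
  have dom: "AE z in ?P. \<exists>!n. z \<in> A n"
    using enum_P
  proof eventually_elim
    fix z assume z: "z \<in> space ?P \<and> inj (\<lambda>n. p n (fst z)) \<and> fst z = range (\<lambda>n. p n (fst z))"
    then have "\<pi> z \<in> range (\<lambda>n. p n (fst z))"
      using \<pi>_in[of "fst z" "snd z"] by auto
    then show "\<exists>!n. z \<in> A n"
      using z by (auto simp: A_def inj_def)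
  qed
  \<comment> \<open>The image pieces partition the space: the preimage \<open>z'\<close> of \<open>z\<close> under the bijective point-shift
    is reached from \<open>z\<close> by moving the origin to \<open>- \<pi> z'\<close>. This is the old origin, hence a point of
    the configuration of \<open>z\<close>, and so it equals \<open>p m\<close> there for exactly one \<open>m\<close>; the index of the
    piece is then \<open>- m\<close>.\<close>
  have ran: "AE z in ?P. \<exists>!n. \<tau> (- n) z \<in> A n"
    using enum_P
  proof eventually_elim
    fix z assume z: "z \<in> space ?P \<and> inj (\<lambda>n. p n (fst z)) \<and> fst z = range (\<lambda>n. p n (fst z))"
    have z_in: "z \<in> space ?P" using z by blast
    have fst_in: "fst z \<in> space configurations0" using z_in by (auto simp: space_P)
    have "z \<in> ?T ` space ?P"
      using bij_betw_imp_surj_on[OF bij] z_in by (simp only: space_P)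
    then obtain z' where z': "z' \<in> space ?P" "?T z' = z" by blast
    have "0 \<in> fst z'" using z' by (auto simp: space_P space_configurations0)
    then have "- \<pi> z' \<in> fst z"
      unfolding z'(2)[symmetric] by (force simp: field_point_shift_def config_shift_def split: prod.split)
    then obtain m where m: "- \<pi> z' = p m (fst z)" using z by auto
    have z'_eq: "z' = \<tau> m z"
    proof -
      have "\<tau> m z = (config_shift (fst z) (- \<pi> z'), field_shift (snd z) (- \<pi> z'))"
        by (cases z) (use m in \<open>simp add: \<tau> point_shift_def\<close>)
      also have "\<dots> = z'"
        unfolding z'(2)[symmetric]
        by (cases z') (simp add: field_point_shift_def config_shift_minus, simp add: field_shift_def)
      finally show ?thesis ..
    qed
    show "\<exists>!n. \<tau> (- n) z \<in> A n"
    proof (rule ex1I[of _ "- m"])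
      have "p (- m) (fst (\<tau> m z)) = - p m (fst z)"
        by (cases z) (use fst_in in \<open>simp add: \<tau> p_inv\<close>)
      then show "\<tau> (- (- m)) z \<in> A (- m)"
        using z' m[symmetric] by (simp add: A_def z'_eq[symmetric])
    next
      fix n assume n: "\<tau> (- n) z \<in> A n"
      have "\<tau> n (\<tau> (- n) z) = z" using \<tau>_inv[OF z_in, of "- n"] by simp
      then have "?T (\<tau> (- n) z) = ?T z'" using T_eq[OF n] z' by simp
      then have eq: "\<tau> (- n) z = z'"
        using bij n z' by (auto simp: bij_betw_def space_P A_def dest: inj_onD)
      have "p n (fst (\<tau> (- n) z)) = - p (- n) (fst z)"
        by (cases z) (use fst_in p_inv[of "fst z" "- n"] in \<open>simp add: \<tau>\<close>)
      then have "p (- n) (fst z) = p m (fst z)"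
        using n m by (simp add: A_def eq)
      then have "- n = m" using z by (auto simp: inj_def)
      then show "n = - m" by simp
    qed
  qed
  show ?meas by (rule T_meas)
  show ?pres
    by (rule distr_piecewise_measure_preserving[where \<theta> = \<tau> and \<theta>' = "\<lambda>n. \<tau> (- n)" and A = A])
      (fact \<tau>_meas \<tau>_inv \<tau>_pres T_meas A_sets T_eq dom ran)+
qed

theorem theorem5p1:
  fixes M :: "'m measure"
    and S :: "'m \<Rightarrow> (real ^ 'd) set"
    and \<pi> :: "int \<Rightarrow> (real ^ 'd) set \<Rightarrow> real ^ 'd"
  assumes "prob_space M"
    and "S \<in> M \<rightarrow>\<^sub>M configurations0"
    and "\<And>n. point_map (\<pi> n)"
    and "\<And>n \<omega>. \<omega> \<in> space configurations0 \<Longrightarrow> \<pi> (- n) (point_shift (\<pi> n) \<omega>) = - \<pi> n \<omega>"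
    and "AE m in M. inj (\<lambda>n. \<pi> n (S m))"
    and "AE m in M. S m = range (\<lambda>n. \<pi> n (S m))"
    and "\<And>n. distr M configurations0 (\<lambda>m. config_shift (S m) (\<pi> n (S m))) = distr M configurations0 S"
  shows "point_stationary TYPE('w) TYPE('e) M S"
  unfolding point_stationary_def
proof (intro allI impI)
  fix N :: "'w measure" and S' :: "'w \<Rightarrow> (real ^ 'd) set" and E :: "'e measure"
    and L :: "(real ^ 'd \<Rightarrow> 'e) set" and Y :: "'w \<Rightarrow> real ^ 'd \<Rightarrow> 'e"
    and \<rho> :: "(real ^ 'd) set \<times> (real ^ 'd \<Rightarrow> 'e) \<Rightarrow> real ^ 'd"
  assume N: "prob_space N"
    and S': "S' \<in> N \<rightarrow>\<^sub>M configurations0" "distr N configurations0 S' = distr M configurations0 S"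
    and L: "shift_measurable E L" and Y: "stationary_field N E L Y"
    and ind: "independent_elements N configurations0 S' (path_space E L) Y"
    and \<rho>: "field_point_map E L \<rho>"
    and bij: "bij_betw (field_point_shift \<rho>) (space configurations0 \<times> L) (space configurations0 \<times> L)"
  interpret M: prob_space M by fact
  interpret N: prob_space N by fact
  let ?C = "configurations0 :: (real ^ 'd) set measure"
  let ?L = "path_space E L"
  let ?\<mu> = "distr M ?C S" and ?\<nu> = "distr N ?L Y"
  note S = assms(2) and p = assms(3)
  have Y_meas: "Y \<in> N \<rightarrow>\<^sub>M ?L" using Y by (simp add: stationary_field_def)
  have pshift_meas: "point_shift (\<pi> n) \<in> ?C \<rightarrow>\<^sub>M ?C" for n
    unfolding point_shift_def[abs_def] using p[of n]
    by (intro measurable_config_shift0 measurable_ident_sets refl) (auto simp: point_map_def)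
  have fshift_meas: "(\<lambda>y. field_shift y v) \<in> ?L \<rightarrow>\<^sub>M ?L" for v
  proof -
    have "(\<lambda>y. (y, v)) \<in> ?L \<rightarrow>\<^sub>M ?L \<Otimes>\<^sub>M borel" by measurable
    from measurable_compose[OF this] L show ?thesis
      by (fastforce simp: shift_measurable_def)
  qed
  have enum: "AE \<omega> in ?\<mu>. inj (\<lambda>n. \<pi> n \<omega>) \<and> \<omega> = range (\<lambda>n. \<pi> n \<omega>)"
    using assms(5,6) sets_enumerated_configurations[OF p]
    by (subst AE_distr_iff[OF S]) auto
  have \<mu>_shift: "distr ?\<mu> ?C (point_shift (\<pi> n)) = ?\<mu>" for n
    using assms(7)[of n] by (simp add: distr_distr[OF pshift_meas S] o_def point_shift_def)
  have \<nu>_shift: "distr ?\<nu> ?L (\<lambda>y. field_shift y v) = ?\<nu>" for v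
    using Y by (simp add: distr_distr[OF fshift_meas Y_meas] o_def stationary_field_def)
  note T = distr_field_point_shift[OF M.prob_space_distr[OF S] sets_distr
      N.prob_space_distr[OF Y_meas] sets_distr L \<nu>_shift p assms(4) enum \<mu>_shift \<rho> bij]
  \<comment> \<open>The copy \<open>S'\<close> enters through its law only, so the joint law is built from the law of \<open>S\<close>.\<close>
  have joint: "distr N (?\<mu> \<Otimes>\<^sub>M ?\<nu>) (\<lambda>w. (S' w, Y w)) = ?\<mu> \<Otimes>\<^sub>M ?\<nu>"
    using distr_Pair_independent_elements[OF N ind] S'(2)
    by (simp cong: distr_cong sets_pair_measure_cong)
  have pair_meas: "(\<lambda>w. (S' w, Y w)) \<in> N \<rightarrow>\<^sub>M ?\<mu> \<Otimes>\<^sub>M ?\<nu>"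
    using S'(1) Y_meas by (intro measurable_Pair) simp_all
  have fst_meas: "fst \<in> ?\<mu> \<Otimes>\<^sub>M ?\<nu> \<rightarrow>\<^sub>M ?C"
    using measurable_fst[of ?\<mu> ?\<nu>] by simp
  have "distr N ?C (\<lambda>w. config_shift (S' w) (\<rho> (S' w, Y w)))
      = distr N ?C (fst \<circ> (field_point_shift \<rho> \<circ> (\<lambda>w. (S' w, Y w))))"
    by (simp add: o_def field_point_shift_def)
  also have "\<dots> = distr (distr (distr N (?\<mu> \<Otimes>\<^sub>M ?\<nu>) (\<lambda>w. (S' w, Y w)))
      (?\<mu> \<Otimes>\<^sub>M ?\<nu>) (field_point_shift \<rho>)) ?C fst"
    by (simp only: distr_distr[OF T(1) pair_meas] distr_distr[OF fst_meas measurable_comp[OF pair_meas T(1)]])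
  also have "\<dots> = distr (distr N (?\<mu> \<Otimes>\<^sub>M ?\<nu>) (\<lambda>w. (S' w, Y w))) ?C fst"
    by (simp only: joint T(2))
  also have "\<dots> = distr N ?C S'"
    by (simp add: distr_distr[OF fst_meas pair_meas] o_def)
  finally show "distr N ?C (\<lambda>w. config_shift (S' w) (\<rho> (S' w, Y w))) = distr N ?C S'" .
qed

end
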